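(* Let $F$ be a field, let $\lambda\ge 0$ be an integer, and let $A_1,\dots,A_n$ be $\lambda$-null finite subsets of $F$. Assume that a polynomial $f\in F[X_1,\dots,X_n]$ contains a monomial $X_1^{k_1}\cdots X_n^{k_n}$ with non-zero coefficient, such that $k_1<|A_1|,\dots,k_n<|A_n|$ and \[\deg(f)\leq k_1+\dots+k_n+\lambda.\] Then $f(a)\neq 0$ for some grid point $a\in A_1\times\dots\times A_n$.
   Context: For a finite non-empty subset $A\subseteq F$, its characteristic polynomial is $\Pi_A(X)=\prod_{a\in A}(X-a)\in F[X]$. For $\lambda\in\{0,\dots,|A|\}$, $A$ is called $\lambda$-null if in $\Pi_A(X)$ the coefficients of $X^{|A|-1},\dots,X^{|A|-\lambda}$ all vanish. $\deg(f)$ denotes the total degree of $f$. *)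

theory Defs
  imports
    Main
    "HOL-Library.FuncSet"
    "HOL-Library.Poly_Mapping"
    "HOL-Computational_Algebra.Polynomial"
begin

definition set_char_poly :: "'a::field set \<Rightarrow> 'a poly" where
  "set_char_poly A = (\<Prod>a\<in>A. [:- a, 1:])"

text \<open>The bound \<open>l \<le> card A\<close> is part of the notion, so a \<open>l\<close>-null set always has
  at least \<open>l\<close> elements and the subtraction below never truncates.\<close>

definition null_set :: "nat \<Rightarrow> 'a::field set \<Rightarrow> bool" where
  "null_set l A \<longleftrightarrow> finite A \<and> A \<noteq> {} \<and> l \<le> card A \<and>
     (\<forall>j\<in>{1..l}. poly.coeff (set_char_poly A) (card A - j) = 0)"

text \<open>Multivariate polynomials in variables indexed by natural numbers: an exponent vector is a
  finitely supported function \<open>nat \<Rightarrow>\<^sub>0 nat\<close>, a polynomial is a finitely supported family of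
  coefficients indexed by exponent vectors.\<close>

type_synonym 'a mpol = "(nat \<Rightarrow>\<^sub>0 nat) \<Rightarrow>\<^sub>0 'a"

text \<open>The ring \<open>F[X\<^sub>1, \<dots>, X\<^sub>n]\<close>.\<close>

definition mpols :: "nat \<Rightarrow> 'a::zero mpol set" where
  "mpols n = {f. \<forall>m\<in>Poly_Mapping.keys f. Poly_Mapping.keys m \<subseteq> {1..n}}"

definition monom_degree :: "(nat \<Rightarrow>\<^sub>0 nat) \<Rightarrow> nat" where
  "monom_degree m = (\<Sum>i\<in>Poly_Mapping.keys m. Poly_Mapping.lookup m i)"

text \<open>The zero polynomial gets total degree \<open>0\<close>.\<close>

definition total_deg :: "'a::zero mpol \<Rightarrow> nat" where
  "total_deg f = Max (insert 0 (monom_degree ` Poly_Mapping.keys f))"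

definition eval_mpol :: "'a::comm_semiring_1 mpol \<Rightarrow> (nat \<Rightarrow> 'a) \<Rightarrow> 'a" where
  "eval_mpol f a = (\<Sum>m\<in>Poly_Mapping.keys f. Poly_Mapping.lookup f m * (\<Prod>i\<in>Poly_Mapping.keys m. a i ^ Poly_Mapping.lookup m i))"

end

theory Submission
  imports Defs
begin

text \<open>For each \<open>i\<close> take the linear functional
  \<open>L\<^sub>i(g) = (\<Sum>a\<in>A\<^sub>i. w\<^sub>i(a) g(a))\<close> that extracts the coefficient of \<open>X^k\<^sub>i\<close>
  from the remainder of \<open>g\<close> modulo the characteristic polynomial of \<open>A\<^sub>i\<close>. Since \<open>A\<^sub>i\<close> is \<open>l\<close>-null,
  every reduction step lowers exponents by more than \<open>l\<close>, so \<open>L\<^sub>i(X^m) \<noteq> 0\<close> forces \<open>m = k\<^sub>i\<close> or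
  \<open>m > k\<^sub>i + l\<close>. By the degree bound, the tensor product of the \<open>L\<^sub>i\<close> kills every monomial of \<open>f\<close>
  except \<open>X^k\<close>, so it maps \<open>f\<close> to the nonzero coefficient of that monomial; yet it is a linear
  combination of the values of \<open>f\<close> on the grid.\<close>

lemma degree_prod_linear:
  fixes A :: "'a::field set"
  assumes "finite A"
  shows "degree (\<Prod>a\<in>A. [:- a, 1:]) = card A"
  using degree_prod_eq_sum_degree[of A "\<lambda>a. [:- a, 1:]"] by simp

lemma degree_set_char_poly: "finite A \<Longrightarrow> degree (set_char_poly A) = card A"
  by (simp add: set_char_poly_def degree_prod_linear)

lemma coeff_set_char_poly_card: "finite A \<Longrightarrow> poly.coeff (set_char_poly A) (card A) = 1"
  using lead_coeff_prod[of "\<lambda>a. [:- a, 1:]" A]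
  by (simp add: degree_prod_linear set_char_poly_def)

lemma poly_set_char_poly_eq_0: "finite A \<Longrightarrow> a \<in> A \<Longrightarrow> poly (set_char_poly A) a = 0"
  by (auto simp: set_char_poly_def poly_prod)

text \<open>Lagrange interpolation: \<open>p\<close> equals the sum of its values times the basis
  polynomials \<open>B a\<close>, so the weight \<open>w a\<close> is the coefficient of
  \<open>X^k\<close> in \<open>B a\<close>.\<close>

lemma coeff_as_weighted_sum_of_values:
  fixes A :: "'a::field set"
  assumes fin: "finite A"
  obtains w where "\<And>p. degree p < card A \<Longrightarrow> (\<Sum>a\<in>A. w a * poly p a) = poly.coeff p k"
proof
  define q where "q a = (\<Prod>b\<in>A - {a}. [:- b, 1:])" for a
  define B where "B a = smult (inverse (poly (q a) a)) (q a)" for a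
  have q_nz: "poly (q a) a \<noteq> 0" for a
    using fin by (auto simp: q_def poly_prod)
  have B_val: "poly (B a) b = (if a = b then 1 else 0)" if "b \<in> A" for a b
    using that fin q_nz[of a] by (auto simp: B_def q_def poly_prod)
  have B_deg: "degree (B a) < card A" if "a \<in> A" for a
  proof -
    have "degree (q a) = card (A - {a})"
      using fin by (simp add: q_def degree_prod_linear)
    then show ?thesis
      using fin that degree_smult_le[of "inverse (poly (q a) a)" "q a"]
      by (metis B_def card_Diff1_less le_less_trans)
  qed
  fix p :: "'a poly"
  assume p: "degree p < card A"
  have "(\<Sum>a\<in>A. smult (poly p a) (B a)) = p"
  proof (rule poly_eqI_degree[of A])
    show "poly (\<Sum>a\<in>A. smult (poly p a) (B a)) x = poly p x" if "x \<in> A" for x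
    proof -
      have "poly (\<Sum>a\<in>A. smult (poly p a) (B a)) x = (\<Sum>a\<in>A. if a = x then poly p a else 0)"
        unfolding poly_sum using that by (intro sum.cong) (auto simp: B_val)
      then show ?thesis using fin that by simp
    qed
    show "degree (\<Sum>a\<in>A. smult (poly p a) (B a)) < card A"
      using p B_deg by (intro degree_sum_less) (auto intro: le_less_trans[OF degree_smult_le])
  qed (fact p)
  then have "poly.coeff p k = (\<Sum>a\<in>A. poly.coeff (smult (poly p a) (B a)) k)"
    by (metis coeff_sum)
  then show "(\<Sum>a\<in>A. poly.coeff (B a) k * poly p a) = poly.coeff p k"
    by (simp add: mult.commute)
qed

text \<open>The characteristic polynomial vanishes at \<open>a\<close>; solve for its leading power
  and multiply by \<open>a ^ (m - card A)\<close>. Nullity removes the \<open>l\<close> terms just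
  below the leading one, so every exponent on the right is less than \<open>m - l\<close>.\<close>

lemma power_eq_sum_null_set:
  assumes null: "null_set l A" and a: "a \<in> A" and m: "card A \<le> m"
  shows "a ^ m = - (\<Sum>j<card A - l. poly.coeff (set_char_poly A) j * a ^ (m - card A + j))"
proof -
  let ?c = "poly.coeff (set_char_poly A)"
  have fin: "finite A" and vanish: "\<And>j. j \<in> {1..l} \<Longrightarrow> ?c (card A - j) = 0"
    using null by (auto simp: null_set_def)
  have zero: "?c j = 0" if "j < card A" "\<not> j < card A - l" for j
  proof -
    have "card A - j \<in> {1..l}" "card A - (card A - j) = j" using that by auto
    then show ?thesis using vanish by metis
  qed
  have "(\<Sum>j<card A. ?c j * a ^ j) = (\<Sum>j<card A - l. ?c j * a ^ j)"
    using zero by (intro sum.mono_neutral_right) auto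
  moreover have "(\<Sum>j\<le>card A. ?c j * a ^ j) = 0"
    using poly_set_char_poly_eq_0[OF fin a] by (simp add: poly_altdef degree_set_char_poly fin)
  ultimately have "a ^ card A = - (\<Sum>j<card A - l. ?c j * a ^ j)"
    by (simp add: lessThan_Suc_atMost[symmetric] coeff_set_char_poly_card fin
        add.commute eq_neg_iff_add_eq_0)
  moreover have "a ^ m = a ^ (m - card A) * a ^ card A"
    using m by (simp flip: power_add)
  ultimately show ?thesis
    by (simp add: sum_distrib_left power_add mult_ac)
qed

text \<open>The weights are those reading off the coefficient of \<open>X^k\<close>. For
  \<open>m < card A\<close> they are applied to \<open>X^m\<close> itself; larger powers are reduced
  by strong induction on \<open>m\<close>.\<close>

lemma null_set_weights:
  fixes A :: "'a::field set"
  assumes null: "null_set l A" and k: "k < card A"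
  obtains w where "\<And>m. m \<le> k + l \<Longrightarrow> (\<Sum>a\<in>A. w a * a ^ m) = (if m = k then 1 else 0)"
proof -
  have fin: "finite A" using null by (simp add: null_set_def)
  obtain w where w: "\<And>p. degree p < card A \<Longrightarrow> (\<Sum>a\<in>A. w a * poly p a) = poly.coeff p k"
    using coeff_as_weighted_sum_of_values[OF fin] by metis
  have "(\<Sum>a\<in>A. w a * a ^ m) = (if m = k then 1 else 0)" if "m \<le> k + l" for m
    using that
  proof (induction m rule: less_induct)
    case (less m)
    show ?case
    proof (cases "m < card A")
      case True
      then show ?thesis
        using w[of "monom 1 m"] by (simp add: degree_monom_eq poly_monom)
    next
      case False
      let ?c = "poly.coeff (set_char_poly A)"
      have "(\<Sum>a\<in>A. w a * a ^ m)
          = (\<Sum>a\<in>A. \<Sum>j<card A - l. - ?c j * (w a * a ^ (m - card A + j)))"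
        using False by (intro sum.cong refl, subst power_eq_sum_null_set[OF null])
          (auto simp: sum_distrib_left sum_negf mult_ac)
      also have "\<dots> = (\<Sum>j<card A - l. - ?c j * (\<Sum>a\<in>A. w a * a ^ (m - card A + j)))"
        by (subst sum.swap) (simp add: sum_distrib_left)
      also have "\<dots> = 0"
      proof (intro sum.neutral ballI)
        fix j assume "j \<in> {..<card A - l}"
        \<comment> \<open>The exponent is below \<open>m - l\<close>, and
          \<open>m \<le> k + l\<close>. Being strictly less than \<open>k\<close>, it is never the
          one exponent with value 1, so the induction hypothesis gives 0.\<close>
        then have "m - card A + j < m" "m - card A + j < k"
          using False less.prems by auto
        then show "- ?c j * (\<Sum>a\<in>A. w a * a ^ (m - card A + j)) = 0"
          using less.IH[of "m - card A + j"] by simp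
      qed
      finally show ?thesis using False k by simp
    qed
  qed
  then show ?thesis using that by blast
qed

lemma monom_degree_eq_sum:
  "Poly_Mapping.keys m \<subseteq> {1..n} \<Longrightarrow> monom_degree m = (\<Sum>i=1..n. Poly_Mapping.lookup m i)"
  unfolding monom_degree_def by (rule sum.mono_neutral_left) (auto simp: in_keys_iff)

lemma monom_degree_le_total_deg: "m \<in> Poly_Mapping.keys f \<Longrightarrow> monom_degree m \<le> total_deg f"
  by (simp add: total_deg_def)

lemma eval_mpol_eq_sum:
  fixes f :: "'a::comm_semiring_1 mpol"
  assumes "f \<in> mpols n"
  shows "eval_mpol f a = (\<Sum>m\<in>Poly_Mapping.keys f.
    Poly_Mapping.lookup f m * (\<Prod>i=1..n. a i ^ Poly_Mapping.lookup m i))"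
proof -
  have "(\<Prod>i\<in>Poly_Mapping.keys m. a i ^ Poly_Mapping.lookup m i)
      = (\<Prod>i=1..n. a i ^ Poly_Mapping.lookup m i)" if "m \<in> Poly_Mapping.keys f" for m
    using assms that by (intro prod.mono_neutral_left) (auto simp: mpols_def in_keys_iff)
  then show ?thesis unfolding eval_mpol_def by (auto intro: sum.cong)
qed

text \<open>Product weights turn the grid sum of a monomial into a product of one-variable sums, by
  distributivity.\<close>

lemma sum_weighted_eval_mpol:
  fixes f :: "'a::comm_semiring_1 mpol"
  assumes f: "f \<in> mpols n" and fin: "\<And>i. i \<in> {1..n} \<Longrightarrow> finite (A i)"
  shows "(\<Sum>a\<in>(\<Pi>\<^sub>E i\<in>{1..n}. A i). (\<Prod>i=1..n. w i (a i)) * eval_mpol f a)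
    = (\<Sum>m\<in>Poly_Mapping.keys f. Poly_Mapping.lookup f m *
        (\<Prod>i=1..n. \<Sum>x\<in>A i. w i x * x ^ Poly_Mapping.lookup m i))"
proof -
  have "(\<Sum>a\<in>(\<Pi>\<^sub>E i\<in>{1..n}. A i). (\<Prod>i=1..n. w i (a i)) * eval_mpol f a)
      = (\<Sum>a\<in>(\<Pi>\<^sub>E i\<in>{1..n}. A i). \<Sum>m\<in>Poly_Mapping.keys f. Poly_Mapping.lookup f m *
          (\<Prod>i=1..n. w i (a i) * a i ^ Poly_Mapping.lookup m i))"
    by (simp add: eval_mpol_eq_sum[OF f] sum_distrib_left prod.distrib mult_ac)
  also have "\<dots> = (\<Sum>m\<in>Poly_Mapping.keys f. Poly_Mapping.lookup f m *
      (\<Sum>a\<in>(\<Pi>\<^sub>E i\<in>{1..n}. A i). \<Prod>i=1..n. w i (a i) * a i ^ Poly_Mapping.lookup m i))"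
    by (subst sum.swap) (simp add: sum_distrib_left)
  finally show ?thesis
    using fin by (subst prod_sum_PiE) auto
qed

theorem theorem3p1:
  fixes A :: "nat \<Rightarrow> 'a::field set"
    and f :: "'a mpol"
    and k :: "nat \<Rightarrow>\<^sub>0 nat"
    and l n :: nat
  assumes "\<And>i. i \<in> {1..n} \<Longrightarrow> null_set l (A i)"
    and "f \<in> mpols n"
    and "Poly_Mapping.lookup f k \<noteq> 0"
    and "\<And>i. i \<in> {1..n} \<Longrightarrow> Poly_Mapping.lookup k i < card (A i)"
    and "total_deg f \<le> (\<Sum>i=1..n. Poly_Mapping.lookup k i) + l"
  shows "\<exists>a \<in> (\<Pi>\<^sub>E i\<in>{1..n}. A i). eval_mpol f a \<noteq> 0"
proof -
  let ?k = "Poly_Mapping.lookup k"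
  have keys: "Poly_Mapping.keys m \<subseteq> {1..n}" if "m \<in> Poly_Mapping.keys f" for m
    using assms(2) that by (auto simp: mpols_def)
  have k_in: "k \<in> Poly_Mapping.keys f"
    using assms(3) by (simp add: in_keys_iff)
  have "\<exists>w. \<forall>m \<le> ?k i + l. (\<Sum>x\<in>A i. w x * x ^ m) = (if m = ?k i then 1 else 0)"
    if i: "i \<in> {1..n}" for i
    using null_set_weights[OF assms(1)[OF i] assms(4)[OF i]] by metis
  then obtain w where w: "\<And>i m. i \<in> {1..n} \<Longrightarrow> m \<le> ?k i + l \<Longrightarrow>
      (\<Sum>x\<in>A i. w i x * x ^ m) = (if m = ?k i then 1 else 0)"
    by metis
  define L where "L m = (\<Prod>i=1..n. \<Sum>x\<in>A i. w i x * x ^ Poly_Mapping.lookup m i)" for m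
  have L_k: "L k = 1"
    unfolding L_def by (intro prod.neutral) (simp add: w)
  have L_other: "L m = 0" if m: "m \<in> Poly_Mapping.keys f" "m \<noteq> k" for m
  proof (rule ccontr)
    let ?m = "Poly_Mapping.lookup m"
    assume "L m \<noteq> 0"
    then have "(\<Sum>x\<in>A i. w i x * x ^ ?m i) \<noteq> 0" if "i \<in> {1..n}" for i
      using that by (auto simp: L_def)
    \<comment> \<open>Up to \<open>?k i + l\<close> the only exponent with nonzero weighted sum is
      \<open>?k i\<close>; beyond that bound nothing is known.\<close>
    then have dich: "?m i = ?k i \<or> ?k i + l < ?m i" if "i \<in> {1..n}" for i
      using w[OF that, of "?m i"] that by (metis not_le)
    obtain i where i: "?m i \<noteq> ?k i"
      using m(2) by (meson poly_mapping_eqI)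
    then have i_in: "i \<in> {1..n}"
      using keys[OF m(1)] keys[OF k_in] by (metis in_keys_iff subsetD)
    \<comment> \<open>By \<open>dich\<close>, coordinate \<open>i\<close> alone exceeds
      \<open>?k i\<close> by more than \<open>l\<close>, and no other coordinate falls below that of
      \<open>k\<close>, so the degree of \<open>m\<close> is too large.\<close>
    have "(\<Sum>j=1..n. ?k j) + l = (?k i + l) + (\<Sum>j\<in>{1..n} - {i}. ?k j)"
      using i_in by (simp add: sum.remove[of _ i])
    also have "\<dots> < ?m i + (\<Sum>j\<in>{1..n} - {i}. ?m j)"
    proof (rule add_less_le_mono)
      show "?k i + l < ?m i" using dich[OF i_in] i by simp
      show "(\<Sum>j\<in>{1..n} - {i}. ?k j) \<le> (\<Sum>j\<in>{1..n} - {i}. ?m j)"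
        using dich by (intro sum_mono) fastforce
    qed
    also have "\<dots> = monom_degree m"
      using i_in by (simp add: monom_degree_eq_sum[OF keys[OF m(1)]] sum.remove[of _ i])
    also have "\<dots> \<le> total_deg f"
      using m(1) by (rule monom_degree_le_total_deg)
    finally show False using assms(5) by simp
  qed
  have "(\<Sum>a\<in>(\<Pi>\<^sub>E i\<in>{1..n}. A i). (\<Prod>i=1..n. w i (a i)) * eval_mpol f a)
      = (\<Sum>m\<in>Poly_Mapping.keys f. Poly_Mapping.lookup f m * L m)"
    unfolding L_def using assms(1) by (intro sum_weighted_eval_mpol assms(2)) (simp add: null_set_def)
  also have "\<dots> = (\<Sum>m\<in>Poly_Mapping.keys f. if m = k then Poly_Mapping.lookup f k else 0)"
    by (intro sum.cong) (auto simp: L_k L_other)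
  also have "\<dots> = Poly_Mapping.lookup f k"
    using k_in by simp
  \<comment> \<open>If \<open>f\<close> vanished on the whole grid, the weighted sum would be
    0.\<close>
  finally show ?thesis
    using assms(3) by (metis (no_types, lifting) mult_zero_right sum.neutral)
qed

end
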